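(* Let $1\le p<q$ be relatively prime integers, $\theta=p/q$, $\lambda>0$ real, and $a_k=\lambda\cos(2\pi k\theta)$ for $1\le k\le q$. Let $D(a_1,\dots,a_q)$ denote the determinant of the $q\times q$ periodic tridiagonal matrix with diagonal entries $a_1,\dots,a_q$ described in the context. Then $$D(a_1,a_2,\dots,a_q)=\begin{cases}0 & q\equiv 0\pmod 4,\\ 2\big(1+(\lambda/2)^q\big) & q\equiv 1,3\pmod 4,\\ -4\big(1+(\lambda/2)^q\big) & q\equiv 2\pmod 4,\end{cases}$$ and $\Delta_{\theta,\lambda}(0)=(-1)^{q/2}\,2\,\big(1+(\lambda/2)^q\big)$ for $q$ even.
   Context: $D(a_1,\dots,a_n)$ is the determinant of the $n\times n$ matrix $T+E_{1n}+E_{n1}$, where $T$ is the tridiagonal matrix with diagonal $a_1,\dots,a_n$, all entries on the sub- and super-diagonal equal to $1$, and all other entries $0$, and $E_{ij}$ is the matrix unit. Thus for $n\ge 3$ it is the tridiagonal matrix with in addition $1$'s in the upper right and lower left corners; for $n=2$ the off-diagonal entries are both $2$. For $\theta=p/q$, the discriminant is the polynomial $\Delta_{\theta,\lambda}(x)=\mathrm{Tr}(A_1(x)A_2(x)\cdots A_q(x))$, where $$A_k(x)=\begin{pmatrix} x-\lambda\cos\!\big(2\pi kp/q+\pi/(2q)\big) & -1\\ 1 & 0\end{pmatrix}.$$ *)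

theory Defs
  imports Complex_Main "Jordan_Normal_Form.Determinant"
begin

text \<open>
  Sequences and matrix units are indexed from 1, as in the source, whereas rows and columns of
  \<^typ>\<open>'a mat\<close> are indexed from 0; position \<open>(i, j)\<close> of the source is \<open>(i - 1, j - 1)\<close> here.
\<close>

definition tridiag_mat :: "nat \<Rightarrow> (nat \<Rightarrow> 'a :: comm_ring_1) \<Rightarrow> 'a mat" where
  "tridiag_mat n a = mat n n (\<lambda>(i, j).
     if i = j then a (i + 1) else if i = j + 1 \<or> j = i + 1 then 1 else 0)"

definition matrix_unit :: "nat \<Rightarrow> nat \<Rightarrow> nat \<Rightarrow> 'a :: comm_ring_1 mat" where
  "matrix_unit n k l = mat n n (\<lambda>(i, j). if i + 1 = k \<and> j + 1 = l then 1 else 0)"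

definition periodic_tridiag_mat :: "nat \<Rightarrow> (nat \<Rightarrow> 'a :: comm_ring_1) \<Rightarrow> 'a mat" where
  "periodic_tridiag_mat n a = tridiag_mat n a + matrix_unit n 1 n + matrix_unit n n 1"

text \<open>\<open>D n a\<close> is $D(a_1, \dots, a_n)$; only the values \<open>a 1, \<dots>, a n\<close> matter.\<close>

definition D :: "nat \<Rightarrow> (nat \<Rightarrow> 'a :: comm_ring_1) \<Rightarrow> 'a" where
  "D n a = det (periodic_tridiag_mat n a)"

definition mat_trace :: "'a :: comm_monoid_add mat \<Rightarrow> 'a" where
  "mat_trace M = (\<Sum>i<dim_row M. M $$ (i, i))"

text \<open>
  The matrices $A_k(x)$ have polynomials in \<open>x\<close> as entries, so that the discriminant is
  a polynomial; \<open>[:- c, 1:]\<close> is $x - c$. The phase $\pi/(2q)$ depends on the denominator,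
  so \<open>p\<close> and \<open>q\<close> (coprime in all uses) are the parameters rather than $\theta = p/q$.
\<close>

definition transfer_mat :: "nat \<Rightarrow> nat \<Rightarrow> real \<Rightarrow> nat \<Rightarrow> real poly mat" where
  "transfer_mat p q lam k = mat_of_rows_list 2
     [[[:- (lam * cos (2 * pi * real k * real p / real q + pi / (2 * real q))), 1:], - 1],
      [1, 0]]"

definition discriminant :: "nat \<Rightarrow> nat \<Rightarrow> real \<Rightarrow> real poly" where
  "discriminant p q lam =
     mat_trace (foldr (*) (map (transfer_mat p q lam) [1..<q + 1]) (1\<^sub>m 2))"

end

theory Submission
  imports Defs
begin

text \<open>
  Both quantities are traces of a product of transfer matrices \<open>step_mat c\<close>, with rows \<open>(c, - 1)\<close> and
  \<open>(1, 0)\<close>, over one period of the diagonal \<open>c k = lam * cos (2 * \<pi> * k * p / q + \<phi>)\<close>.  For the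
  discriminant at \<open>0\<close> this is the definition, with \<open>\<phi> = \<pi> / (2 * q)\<close> and the diagonal negated.  For
  the determinant, with \<open>\<phi> = 0\<close>, it is the identity \<open>D_eq_monodromy_trace\<close>: \<open>D\<close> equals the trace
  minus \<open>2 * (- 1) ^ q\<close>.

  Chambers' formula (\<open>chambers_formula\<close>) gives the dependence on the phase: the trace is
  \<open>c + 2 * (- 1) ^ (p * (q + 1)) * (lam / 2) ^ q * cos (q * \<phi>)\<close> for some constant \<open>c\<close>.  As a Laurent
  polynomial in \<open>cis \<phi>\<close> it has degree at most \<open>q\<close> in either direction, and it is invariant under
  \<open>\<phi> \<mapsto> \<phi> + 2 * \<pi> * p / q\<close>, which only rotates the period.  Hence just the frequencies \<open>0\<close> and
  \<open>\<plusminus> q\<close> occur, and the extreme coefficients are products of those of the individual factors.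

  The constant \<open>c\<close> comes from symmetry.  If \<open>q\<close> is odd, then \<open>\<phi> \<mapsto> \<phi> + \<pi>\<close> negates the trace, so \<open>c = 0\<close>.
  If \<open>q\<close> is even, then at \<open>\<phi> = \<pi> / 2\<close> the diagonal vanishes at \<open>k = q / 2\<close> and at \<open>k = q\<close>, and
  is odd under the reflections about these places.  The two halves of the product are then, up
  to sign, transposes of each other, and because \<open>P * J * P\<^sup>T = J\<close> for \<open>P\<close> of determinant \<open>1\<close>
  and \<open>J = step_mat 0\<close>, the trace is \<open>2 * (- 1) ^ (q div 2)\<close> (\<open>monodromy_trace_antisymmetric\<close>).
  Comparison with Chambers' formula gives \<open>c = 2 * (- 1) ^ (q div 2) * (1 + (lam / 2) ^ q)\<close>.
\<close>

section \<open>Matrices of size two\<close>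

definition mat2 :: "'a \<Rightarrow> 'a \<Rightarrow> 'a \<Rightarrow> 'a \<Rightarrow> 'a mat" where
  "mat2 a b c d = mat_of_rows_list 2 [[a, b], [c, d]]"

lemma mat2_dim [simp]: "dim_row (mat2 a b c d) = 2" "dim_col (mat2 a b c d) = 2"
  by (simp_all add: mat2_def mat_of_rows_list_def)

lemma mat2_carrier [simp]: "mat2 a b c d \<in> carrier_mat 2 2"
  by (rule carrier_matI) simp_all

lemma mat2_index [simp]:
  "mat2 a b c d $$ (0, 0) = a" "mat2 a b c d $$ (0, Suc 0) = b"
  "mat2 a b c d $$ (Suc 0, 0) = c" "mat2 a b c d $$ (Suc 0, Suc 0) = d"
  by (simp_all add: mat2_def mat_of_rows_list_def)

lemma less_2_cases_Suc: "i < (2::nat) \<Longrightarrow> i = 0 \<or> i = Suc 0"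
  by auto

lemma mat2_cases:
  assumes "M \<in> carrier_mat 2 2"
  obtains a b c d where "M = mat2 a b c d"
proof
  show "M = mat2 (M $$ (0, 0)) (M $$ (0, Suc 0)) (M $$ (Suc 0, 0)) (M $$ (Suc 0, Suc 0))"
    using assms by (intro eq_matI) (auto dest!: less_2_cases_Suc)
qed

lemma mat2_inject [simp]:
  "mat2 a b c d = mat2 a' b' c' d' \<longleftrightarrow> a = a' \<and> b = b' \<and> c = c' \<and> d = d'"
  by (metis mat2_index)

lemma mat2_one: "1\<^sub>m 2 = mat2 1 0 0 (1 :: 'a :: comm_ring_1)"
  by (intro eq_matI) (auto dest!: less_2_cases_Suc)

lemma mat2_mult:
  "mat2 a b c d * mat2 a' b' c' d' =
     mat2 (a * a' + b * c') (a * b' + b * d') (c * a' + d * c') (c * b' + d * (d' :: 'a :: comm_ring_1))"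
  (is "?L = ?R")
proof (rule eq_matI)
  fix i j assume "i < dim_row ?R" "j < dim_col ?R"
  then have ij: "i < 2" "j < 2" by simp_all
  have "{0..<2::nat} = {0, Suc 0}" by auto
  then have "?L $$ (i, j) = mat2 a b c d $$ (i, 0) * mat2 a' b' c' d' $$ (0, j)
      + mat2 a b c d $$ (i, Suc 0) * mat2 a' b' c' d' $$ (Suc 0, j)"
    using ij by (simp add: scalar_prod_def)
  also have "\<dots> = ?R $$ (i, j)"
    using ij[THEN less_2_cases_Suc] by (elim disjE) simp_all
  finally show "?L $$ (i, j) = ?R $$ (i, j)" .
qed simp_all

lemma mat2_trace: "mat_trace (mat2 a b c d) = a + (d :: 'a :: comm_ring_1)"
proof -
  have "{..<2::nat} = {0, Suc 0}" by auto
  then show ?thesis by (simp add: mat_trace_def)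
qed

lemma mat2_det: "det (mat2 a b c d) = a * d - b * (c :: 'a :: comm_ring_1)"
proof -
  have "det (mat2 a b c d) = (\<Sum>i<2. mat2 a b c d $$ (i, 0) * cofactor (mat2 a b c d) i 0)"
    by (rule laplace_expansion_column) auto
  also have "{..<2::nat} = {0, Suc 0}" by auto
  finally have "det (mat2 a b c d) =
      a * cofactor (mat2 a b c d) 0 0 + c * cofactor (mat2 a b c d) (Suc 0) 0"
    by simp
  moreover have "cofactor (mat2 a b c d) 0 0 = d"
    unfolding cofactor_def
    by (subst det_single) (auto simp: mat_delete_def mat2_def mat_of_rows_list_def)
  moreover have "cofactor (mat2 a b c d) (Suc 0) 0 = - b"
    unfolding cofactor_def
    by (subst det_single) (auto simp: mat_delete_def mat2_def mat_of_rows_list_def)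
  ultimately show ?thesis
    by (simp add: algebra_simps)
qed

section \<open>Transfer matrices and the trace of the monodromy\<close>

abbreviation step_mat :: "'a :: comm_ring_1 \<Rightarrow> 'a mat" where
  "step_mat c \<equiv> mat2 c (- 1) 1 0"

definition monodromy :: "'a :: comm_ring_1 list \<Rightarrow> 'a mat" where
  "monodromy cs = foldr (*) (map step_mat cs) (1\<^sub>m 2)"

definition monodromy_trace :: "'a :: comm_ring_1 list \<Rightarrow> 'a" where
  "monodromy_trace cs = mat_trace (monodromy cs)"

lemma monodromy_Nil: "monodromy [] = mat2 1 0 0 1"
  by (simp add: monodromy_def mat2_one)

lemma monodromy_Cons: "monodromy (c # cs) = step_mat c * monodromy cs"
  by (simp add: monodromy_def)

lemma monodromy_carrier: "monodromy cs \<in> carrier_mat 2 2"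
  by (induction cs) (auto simp: monodromy_Nil monodromy_Cons intro: mult_carrier_mat)

lemma monodromy_mat2E:
  obtains a b c d where "monodromy cs = mat2 a b c d"
  using mat2_cases[OF monodromy_carrier] by metis

lemma monodromy_append: "monodromy (xs @ ys) = monodromy xs * monodromy ys"
proof (induction xs)
  case Nil
  show ?case by (simp add: monodromy_Nil mat2_one[symmetric] left_mult_one_mat[OF monodromy_carrier])
next
  case (Cons x xs)
  show ?case
    by (simp add: monodromy_Cons Cons assoc_mult_mat[OF mat2_carrier monodromy_carrier monodromy_carrier])
qed

lemma monodromy_trace_rotate: "monodromy_trace (xs @ ys) = monodromy_trace (ys @ xs)"
proof -
  obtain a b c d where "monodromy xs = mat2 a b c d" by (rule monodromy_mat2E)
  moreover obtain a' b' c' d' where "monodromy ys = mat2 a' b' c' d'" by (rule monodromy_mat2E)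
  ultimately show ?thesis
    by (simp add: monodromy_trace_def monodromy_append mat2_mult mat2_trace algebra_simps)
qed

lemma monodromy_det: "monodromy cs = mat2 a b c d \<Longrightarrow> a * d - b * c = 1"
proof -
  have "det (monodromy cs) = 1"
    by (induction cs)
      (simp_all add: monodromy_Nil monodromy_Cons mat2_det det_mult[OF mat2_carrier monodromy_carrier])
  then show "monodromy cs = mat2 a b c d \<Longrightarrow> a * d - b * c = 1"
    by (simp add: mat2_det)
qed

text \<open>
  With \<open>S\<close> the diagonal matrix with entries \<open>1, - 1\<close>, each factor satisfies
  \<open>step_mat (- c) = - S * step_mat c * S\<close>, and the inner copies of \<open>S\<close> cancel in pairs.
\<close>

lemma monodromy_uminus:
  assumes "monodromy cs = mat2 a b c d"
  shows "monodromy (map uminus cs) =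
    mat2 ((- 1) ^ length cs * a) (- ((- 1) ^ length cs * b))
         (- ((- 1) ^ length cs * c)) ((- 1) ^ length cs * d)"
  using assms
proof (induction cs arbitrary: a b c d)
  case Nil
  then show ?case by (auto simp: monodromy_Nil)
next
  case (Cons x cs)
  obtain a' b' c' d' where M: "monodromy cs = mat2 a' b' c' d'" by (rule monodromy_mat2E)
  have eqs: "a = x * a' - c'" "b = x * b' - d'" "c = a'" "d = b'"
    using Cons.prems by (auto simp: monodromy_Cons M mat2_mult)
  show ?case
    by (simp add: eqs monodromy_Cons Cons.IH[OF M] mat2_mult algebra_simps)
qed

text \<open>
  The transpose of \<open>step_mat c\<close> is \<open>S * step_mat c * S\<close>, with the same sign matrix \<open>S\<close>, so
  reversing the product amounts to a transposition followed by conjugation with \<open>S\<close>.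
\<close>

lemma monodromy_rev:
  assumes "monodromy cs = mat2 a b c d"
  shows "monodromy (rev cs) = mat2 a (- c) (- b) d"
  using assms
proof (induction cs arbitrary: a b c d)
  case Nil
  then show ?case by (auto simp: monodromy_Nil)
next
  case (Cons x cs)
  obtain a' b' c' d' where M: "monodromy cs = mat2 a' b' c' d'" by (rule monodromy_mat2E)
  have eqs: "a = x * a' - c'" "b = x * b' - d'" "c = a'" "d = b'"
    using Cons.prems by (auto simp: monodromy_Cons M mat2_mult)
  show ?case
    by (simp add: eqs monodromy_append monodromy_Cons monodromy_Nil Cons.IH[OF M] mat2_mult algebra_simps)
qed

lemma monodromy_trace_uminus:
  "monodromy_trace (map uminus cs) = (- 1) ^ length cs * monodromy_trace cs"
proof -
  obtain a b c d where "monodromy cs = mat2 a b c d" by (rule monodromy_mat2E)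
  then show ?thesis
    by (simp add: monodromy_trace_def monodromy_uminus mat2_trace algebra_simps)
qed

text \<open>
  A period that has two zeros half a period apart and is odd under the reflection about
  each of them has a trace that does not depend on its other entries.  Writing \<open>P\<close> for the
  monodromy of \<open>cs\<close> and \<open>J = step_mat 0\<close>, combining sign change and reversal turns the second
  half into the transpose of \<open>P\<close> up to the sign \<open>(- 1) ^ length cs\<close>.  The trace is therefore
  that sign times the trace of \<open>P * J * P\<^sup>T * J\<close>, and \<open>P * J * P\<^sup>T = det P \<sqdot> J = J\<close> while \<open>J\<^sup>2\<close> is minus
  the identity.
\<close>

lemma monodromy_trace_antisymmetric:
  "monodromy_trace (cs @ [0] @ map uminus (rev cs) @ [0]) = - 2 * (- 1) ^ length cs"
proof -
  obtain a b c d where M: "monodromy cs = mat2 a b c d" by (rule monodromy_mat2E)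
  have "monodromy_trace (cs @ [0] @ map uminus (rev cs) @ [0]) =
      - 2 * (- 1) ^ length cs * (a * d - b * c)"
    by (simp add: monodromy_trace_def monodromy_append monodromy_Cons monodromy_Nil
      monodromy_uminus[OF monodromy_rev[OF M]] M mat2_trace mat2_mult algebra_simps)
  then show ?thesis
    by (simp add: monodromy_det[OF M])
qed

text \<open>
  Used for the embedding of the reals into the complex numbers and for the evaluation of
  polynomials.
\<close>

lemma monodromy_trace_hom:
  assumes "\<And>x y. h (x + y) = h x + h y" "\<And>x y. h (x * y) = h x * h y" "h 1 = 1"
  shows "h (monodromy_trace cs) = monodromy_trace (map h cs)"
proof -
  have h0: "h 0 = 0" using assms(1)[of 0 0] by simp
  have hm: "h (- x) = - h x" for x
    using assms(1)[of x "- x"] h0 by (simp add: eq_neg_iff_add_eq_0 add.commute)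
  have hd: "h (x - y) = h x - h y" for x y
    using assms(1)[of x "- y"] hm by simp
  have "monodromy cs = mat2 a b c d \<Longrightarrow> monodromy (map h cs) = mat2 (h a) (h b) (h c) (h d)" for a b c d
  proof (induction cs arbitrary: a b c d)
    case Nil
    then show ?case by (auto simp: monodromy_Nil assms h0)
  next
    case (Cons x cs)
    obtain a' b' c' d' where M: "monodromy cs = mat2 a' b' c' d'" by (rule monodromy_mat2E)
    show ?case
      using Cons.prems
      by (auto simp: M monodromy_Cons Cons.IH[OF M] mat2_mult assms h0 hm hd)
  qed
  moreover obtain a b c d where "monodromy cs = mat2 a b c d" by (rule monodromy_mat2E)
  ultimately show ?thesis by (simp add: monodromy_trace_def mat2_trace assms)
qed

section \<open>The periodic determinant\<close>

text \<open>
  The solution, for \<open>k \<ge> 1\<close>, of \<open>u (k - 1) + a k * u k + u (k + 1) = 0\<close> with initial values \<open>u\<close> at \<open>0\<close> and \<open>v\<close>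
  at \<open>1\<close>, that is, of the equations that the rows of the tridiagonal matrix express.
\<close>

fun jacobi_sol :: "(nat \<Rightarrow> 'a :: comm_ring_1) \<Rightarrow> 'a \<Rightarrow> 'a \<Rightarrow> nat \<Rightarrow> 'a" where
  "jacobi_sol a u v 0 = u"
| "jacobi_sol a u v (Suc 0) = v"
| "jacobi_sol a u v (Suc (Suc k)) = - a (Suc k) * jacobi_sol a u v (Suc k) - jacobi_sol a u v k"

text \<open>
  Right multiplication by \<open>step_mat (- a k)\<close> carries the row \<open>(u k, - u (k - 1))\<close> to
  \<open>(u (k + 1), - u k)\<close>; the two rows of the identity matrix give the two sets of initial values.
\<close>

lemma monodromy_jacobi_sol:
  "monodromy (map (\<lambda>k. - a k) [1..<n + 1]) =
     mat2 (jacobi_sol a 0 1 (Suc n)) (- jacobi_sol a 0 1 n)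
          (jacobi_sol a (- 1) 0 (Suc n)) (- jacobi_sol a (- 1) 0 n)"
proof (induction n)
  case 0
  show ?case by (simp add: monodromy_Nil)
next
  case (Suc n)
  have "monodromy (map (\<lambda>k. - a k) [1..<Suc n + 1]) =
      monodromy (map (\<lambda>k. - a k) [1..<n + 1]) * step_mat (- a (Suc n))"
    by (simp add: monodromy_append monodromy_Cons monodromy_Nil mat2_mult)
  then show ?case
    unfolding Suc.IH by (simp add: mat2_mult algebra_simps)
qed

lemma periodic_tridiag_mat_carrier [simp]: "periodic_tridiag_mat n a \<in> carrier_mat n n"
  by (simp add: periodic_tridiag_mat_def tridiag_mat_def matrix_unit_def)

text \<open>
  Row \<open>i\<close> sees its cyclic predecessor and successor.  Writing the entry as a sum, rather than
  by cases, covers \<open>n = 2\<close> as well, where the two neighbours coincide and the entry is \<open>2\<close>.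
\<close>

lemma periodic_tridiag_mat_index:
  assumes "2 \<le> n" "i < n" "k < n"
  shows "periodic_tridiag_mat n a $$ (i, k) =
    (if k = i then a (i + 1) else 0) + (if k = (if i = 0 then n - 1 else i - 1) then 1 else 0)
      + (if k = (if i + 1 = n then 0 else i + 1) then 1 else 0)"
  using assms by (auto simp: periodic_tridiag_mat_def tridiag_mat_def matrix_unit_def)

lemma periodic_tridiag_mat_mult_index:
  assumes "2 \<le> n" "i < n" "j < m" "U \<in> carrier_mat n m"
  shows "(periodic_tridiag_mat n a * U) $$ (i, j) =
    a (i + 1) * U $$ (i, j) + U $$ (if i = 0 then n - 1 else i - 1, j)
      + U $$ (if i + 1 = n then 0 else i + 1, j)"
proof -
  have "(periodic_tridiag_mat n a * U) $$ (i, j) =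
      (\<Sum>k<n. periodic_tridiag_mat n a $$ (i, k) * U $$ (k, j))"
    using assms carrier_matD[OF periodic_tridiag_mat_carrier[of n a]]
    by (auto simp: scalar_prod_def atLeast0LessThan)
  also have "\<dots> = (\<Sum>k<n. (if k = i then a (i + 1) * U $$ (k, j) else 0)
      + (if k = (if i = 0 then n - 1 else i - 1) then U $$ (k, j) else 0)
      + (if k = (if i + 1 = n then 0 else i + 1) then U $$ (k, j) else 0))"
    using assms by (intro sum.cong) (auto simp: periodic_tridiag_mat_index algebra_simps)
  also have "\<dots> = a (i + 1) * U $$ (i, j) + U $$ (if i = 0 then n - 1 else i - 1, j)
      + U $$ (if i + 1 = n then 0 else i + 1, j)"
    using assms by (auto simp: sum.distrib)
  finally show ?thesis .
qed

text \<open>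
  The periodic matrix is singular exactly if the recurrence has a nonzero periodic solution, that
  is, if the monodromy of the diagonal \<open>- a\<close> has eigenvalue \<open>1\<close>.  To get the determinant itself,
  replace the first two standard basis vectors by the two fundamental solutions \<open>y\<close> and \<open>x\<close>.  This
  change of basis \<open>U\<close> has determinant \<open>1\<close>.  A solution satisfies all the equations apart from those
  of the first and last rows, where it fails to be periodic.  Once the last row is moved to the
  front, the matrix becomes block triangular, with the transpose of \<open>1 - monodromy\<close> as its \<open>2 \<times> 2\<close>
  block and a unitriangular block below it.  The determinant of \<open>1 - monodromy\<close> is \<open>2\<close> minus the
  trace, because the monodromy has determinant \<open>1\<close>; passing from \<open>- a\<close> to \<open>a\<close> multiplies the trace
  by \<open>(- 1) ^ n\<close>.
\<close>

lemma D_eq_monodromy_trace: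
  fixes a :: "nat \<Rightarrow> 'a :: idom"
  assumes n: "2 \<le> n"
  shows "D n a = monodromy_trace (map a [1..<n + 1]) - 2 * (- 1) ^ n"
proof -
  define y x where "y = jacobi_sol a 0 1" and "x = jacobi_sol a (- 1) 0"
  have M: "monodromy (map (\<lambda>k. - a k) [1..<n + 1]) = mat2 (y (Suc n)) (- y n) (x (Suc n)) (- x n)"
    unfolding y_def x_def by (rule monodromy_jacobi_sol)
  have rec: "a (Suc k) * y (Suc k) + y k + y (Suc (Suc k)) = 0"
    "a (Suc k) * x (Suc k) + x k + x (Suc (Suc k)) = 0" for k
    by (simp_all add: y_def x_def)
  define P where "P = periodic_tridiag_mat n a"
  define U where "U = mat n n (\<lambda>(i, j). if j = 0 then y (i + 1) else if j = 1 then x (i + 1)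
    else if i = j then 1 else 0)"
  have P: "P \<in> carrier_mat n n" and U: "U \<in> carrier_mat n n"
    by (simp_all add: P_def U_def)
  have U_index: "U $$ (i, j) = (if j = 0 then y (i + 1) else if j = 1 then x (i + 1)
    else if i = j then 1 else 0)" if "i < n" "j < n" for i j
    using that by (simp add: U_def)
  have detU: "det U = 1"
  proof -
    have "det U = prod_list (diag_mat U)"
      by (rule det_lower_triangular[OF _ U]) (auto simp: U_def x_def)
    also have "\<dots> = 1"
      unfolding prod_list_diag_prod by (intro prod.neutral) (auto simp: U_def y_def x_def)
    finally show ?thesis .
  qed
  define B where "B = swap_row_to_front P (n - 1)"
  have B_eq: "B = mat n n (\<lambda>(i, j). if i = 0 then P $$ (n - 1, j)
      else if i \<le> n - 1 then P $$ (i - 1, j) else P $$ (i, j))"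
    unfolding B_def by (rule swap_row_to_front_result[OF P]) (use n in auto)
  have B: "B \<in> carrier_mat n n" by (simp add: B_eq)
  have detB: "det B = (- 1) ^ (n - 1) * det P"
    unfolding B_def by (rule swap_row_to_front_det[OF P]) (use n in auto)
  define C where "C = B * U"
  have C: "C \<in> carrier_mat n n" using B U by (simp add: C_def)
  have C_index: "C $$ (i, j) = (P * U) $$ (if i = 0 then n - 1 else i - 1, j)"
    if "i < n" "j < n" for i j
  proof -
    have "i \<le> n - Suc 0" using that by simp
    then show ?thesis using that n B U P by (auto simp: C_def B_eq scalar_prod_def)
  qed
  have PU: "(P * U) $$ (i, j) = a (i + 1) * U $$ (i, j) + U $$ (if i = 0 then n - 1 else i - 1, j)
      + U $$ (if i + 1 = n then 0 else i + 1, j)" if "i < n" "j < n" for i j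
    unfolding P_def by (rule periodic_tridiag_mat_mult_index[OF n that U])
  define Y Z where "Y = mat 2 (n - 2) (\<lambda>(i, j). C $$ (i, j + 2))"
    and "Z = mat (n - 2) (n - 2) (\<lambda>(i, j). C $$ (i + 2, j + 2))"
  define X where "X = mat2 (1 - y (Suc n)) (- x (Suc n)) (y n) (x n + 1)"
  have top: "C $$ (0, 0) = 1 - y (Suc n)" "C $$ (0, 1) = - x (Suc n)"
    "C $$ (1, 0) = y n" "C $$ (1, 1) = x n + 1"
  proof -
    obtain m where m: "n = Suc (Suc m)" using n by (metis add_2_eq_Suc le_Suc_ex)
    have rec': "y (Suc (Suc k)) = - a (Suc k) * y (Suc k) - y k"
      "x (Suc (Suc k)) = - a (Suc k) * x (Suc k) - x k" for k
      by (simp_all add: y_def x_def)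
    have bd: "y 0 = 0" "y (Suc 0) = 1" "x 0 = - 1" "x (Suc 0) = 0"
      by (simp_all add: y_def x_def)
    show "C $$ (0, 0) = 1 - y (Suc n)" "C $$ (0, 1) = - x (Suc n)"
      "C $$ (1, 0) = y n" "C $$ (1, 1) = x n + 1"
      by (simp_all add: C_index PU U_index m rec'[of "Suc m"] rec'[of 0] bd algebra_simps)
  qed
  \<comment> \<open>Below the first two rows, the columns of \<open>y\<close> and \<open>x\<close> vanish by the recurrence.\<close>
  have low: "C $$ (i, j) = 0" if i: "2 \<le> i" "i < n" and j: "j < 2" for i j
  proof -
    obtain m where m: "i = Suc (Suc m)" using i by (metis add_2_eq_Suc le_Suc_ex)
    have m': "Suc (Suc m) \<noteq> n" "Suc m < n" "m < n" "j < n" using i j n m by auto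
    have "C $$ (i, j) = a (Suc (Suc m)) * U $$ (Suc m, j) + U $$ (m, j) + U $$ (Suc (Suc m), j)"
      using i m m' by (simp add: C_index PU)
    also have "\<dots> = 0"
      using j[THEN less_2_cases_Suc] rec[of "Suc m"] m' i m by (auto simp: U_index)
    finally show ?thesis .
  qed
  have "C = four_block_mat X Y (0\<^sub>m (n - 2) 2) Z"
  proof (intro eq_matI)
    fix i j assume ij: "i < dim_row (four_block_mat X Y (0\<^sub>m (n - 2) 2) Z)"
      "j < dim_col (four_block_mat X Y (0\<^sub>m (n - 2) 2) Z)"
    then have "i < n" "j < n" using n by (auto simp: X_def Z_def)
    have "Suc (Suc (k - 2)) = k" if "\<not> k < 2" for k using that by simp
    with \<open>i < n\<close> \<open>j < n\<close> show "C $$ (i, j) = four_block_mat X Y (0\<^sub>m (n - 2) 2) Z $$ (i, j)"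
      using ij n top low
      by (auto simp: X_def Y_def Z_def dest!: less_2_cases_Suc)
  qed (use C n in \<open>auto simp: X_def Z_def\<close>)
  then have "det C = det (four_block_mat X Y (0\<^sub>m (n - 2) 2) Z)"
    by (rule arg_cong)
  also have "\<dots> = det X * det Z"
    by (rule det_four_block_mat_lower_left_zero[where n = 2 and m = "n - 2"])
      (simp_all add: X_def Y_def Z_def)
  also have "det Z = 1"
  proof -
    have "det Z = prod_list (diag_mat Z)"
      by (rule det_lower_triangular[of "n - 2"]) (auto simp: Z_def C_index PU U_index)
    also have "\<dots> = 1"
      unfolding prod_list_diag_prod by (intro prod.neutral) (auto simp: Z_def C_index PU U_index)
    finally show ?thesis .
  qed
  also have "det X = 2 - (y (Suc n) - x n)"
    using monodromy_det[OF M] by (simp add: X_def mat2_det algebra_simps)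
  also have "y (Suc n) - x n = monodromy_trace (map uminus (map a [1..<n + 1]))"
    using M by (simp add: monodromy_trace_def mat2_trace comp_def)
  also have "\<dots> = (- 1) ^ n * monodromy_trace (map a [1..<n + 1])"
    by (simp only: monodromy_trace_uminus length_map length_upt) simp
  finally have detC: "det C = 2 - (- 1) ^ n * monodromy_trace (map a [1..<n + 1])" by simp
  have "det C = (- 1) ^ (n - 1) * D n a"
    unfolding C_def det_mult[OF B U] by (simp add: detU detB D_def P_def)
  then have "(- 1) ^ (n - 1) * ((- 1) ^ (n - 1) * D n a) =
      (- 1) ^ (n - 1) * (2 - (- 1) ^ n * monodromy_trace (map a [1..<n + 1]))"
    using detC by simp
  moreover have "(- 1) ^ (n - 1) * ((- 1) ^ (n - 1) * D n a) = D n a"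
    by (simp add: mult.assoc[symmetric] power_add[symmetric] flip: mult_2)
  moreover have "(- 1 :: 'a) ^ n = - ((- 1) ^ (n - 1))"
    using n by (cases n) auto
  ultimately show ?thesis
    by (simp add: algebra_simps power_add[symmetric] mult.assoc[symmetric] flip: mult_2)
qed

section \<open>Dependence of the trace on the phase\<close>

text \<open>
  After multiplication by \<open>z ^ length l\<close> each entry of the monodromy is a polynomial in \<open>z\<close> of
  degree at most \<open>2 * length l\<close>.  For nonempty \<open>l\<close> only the upper left entry reaches the ends of this
  range: it contains the product of all the diagonal values, whereas all other terms have
  fewer factors.
\<close>

lemma monodromy_laurent:
  fixes l :: "('a :: field \<times> 'a) list"
  shows "\<exists>A B C E :: 'a poly.
    (\<forall>z. z \<noteq> 0 \<longrightarrow> monodromy (map (\<lambda>(u, v). u * z + v / z) l) =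
        mat2 (poly A z / z ^ length l) (poly B z / z ^ length l)
             (poly C z / z ^ length l) (poly E z / z ^ length l)) \<and>
    (\<forall>j > 2 * length l. coeff A j = 0 \<and> coeff B j = 0 \<and> coeff C j = 0 \<and> coeff E j = 0) \<and>
    coeff A 0 = prod_list (map snd l) \<and> coeff A (2 * length l) = prod_list (map fst l) \<and>
    coeff B 0 = 0 \<and> coeff B (2 * length l) = 0 \<and>
    (l \<noteq> [] \<longrightarrow> coeff E 0 = 0 \<and> coeff E (2 * length l) = 0)"
proof (induction l)
  case Nil
  show ?case
    by (intro exI[of _ 1] exI[of _ 0]) (auto simp: monodromy_Nil coeff_1)
next
  case (Cons p l)
  obtain u v where p: "p = (u, v)" by force
  from Cons.IH obtain A B C E :: "'a poly" where
    M: "\<And>z. z \<noteq> 0 \<Longrightarrow> monodromy (map (\<lambda>(u, v). u * z + v / z) l) =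
        mat2 (poly A z / z ^ length l) (poly B z / z ^ length l)
             (poly C z / z ^ length l) (poly E z / z ^ length l)"
    and deg: "\<And>j. j > 2 * length l \<Longrightarrow> coeff A j = 0 \<and> coeff B j = 0 \<and> coeff C j = 0 \<and> coeff E j = 0"
    and ends: "coeff A 0 = prod_list (map snd l)" "coeff A (2 * length l) = prod_list (map fst l)"
      "coeff B 0 = 0" "coeff B (2 * length l) = 0"
    by blast
  \<comment> \<open>The upper row of \<open>step_mat (u * z + v / z) * M\<close>, cleared of denominators, in
    terms of a column \<open>(X, Y)\<close> of \<open>M\<close>.\<close>
  define next_poly where "next_poly X Y = smult v X + pCons 0 (pCons 0 (smult u X)) - pCons 0 Y"
    for X Y :: "'a poly"
  have next_poly: "poly (next_poly X Y) z = (u * z\<^sup>2 + v) * poly X z - z * poly Y z" for X Y z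
    by (simp add: next_poly_def power2_eq_square algebra_simps)
  show ?case
  proof (intro exI conjI allI impI)
    fix z :: 'a assume z: "z \<noteq> 0"
    have scale: "(u * z + v / z) * (x / z ^ length l) - y / z ^ length l =
        ((u * z\<^sup>2 + v) * x - z * y) / z ^ length (p # l)" for x y
      using z by (simp add: field_simps power2_eq_square)
    show "monodromy (map (\<lambda>(u, v). u * z + v / z) (p # l)) =
        mat2 (poly (next_poly A C) z / z ^ length (p # l)) (poly (next_poly B E) z / z ^ length (p # l))
             (poly (pCons 0 A) z / z ^ length (p # l)) (poly (pCons 0 B) z / z ^ length (p # l))"
      using z scale by (simp add: p monodromy_Cons M mat2_mult next_poly)
  next
    fix j assume j: "j > 2 * length (p # l)"
    then obtain i where "j = Suc (Suc i)" "i > 2 * length l"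
      by (metis Suc_lessE length_Cons mult_Suc_right add_2_eq_Suc Suc_less_SucD)
    then show "coeff (next_poly A C) j = 0" "coeff (next_poly B E) j = 0"
      "coeff (pCons 0 A) j = 0" "coeff (pCons 0 B) j = 0"
      using deg by (simp_all add: next_poly_def)
  qed (use ends deg in \<open>simp_all add: next_poly_def p\<close>)
qed

lemma monodromy_trace_laurent:
  fixes l :: "('a :: field \<times> 'a) list"
  assumes "l \<noteq> []"
  obtains F :: "'a poly" where
    "\<And>z. z \<noteq> 0 \<Longrightarrow> monodromy_trace (map (\<lambda>(u, v). u * z + v / z) l) = poly F z / z ^ length l"
    "\<And>j. j > 2 * length l \<Longrightarrow> coeff F j = 0"
    "coeff F 0 = prod_list (map snd l)" "coeff F (2 * length l) = prod_list (map fst l)"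
proof -
  from monodromy_laurent[of l] obtain A B C E :: "'a poly" where
    M: "\<forall>z. z \<noteq> 0 \<longrightarrow> monodromy (map (\<lambda>(u, v). u * z + v / z) l) =
        mat2 (poly A z / z ^ length l) (poly B z / z ^ length l)
             (poly C z / z ^ length l) (poly E z / z ^ length l)"
    and deg: "\<forall>j > 2 * length l. coeff A j = 0 \<and> coeff B j = 0 \<and> coeff C j = 0 \<and> coeff E j = 0"
    and ends: "coeff A 0 = prod_list (map snd l)" "coeff A (2 * length l) = prod_list (map fst l)"
      "coeff E 0 = 0" "coeff E (2 * length l) = 0"
    using assms by blast
  show thesis
    by (rule that[of "A + E"])
      (simp_all add: M deg ends monodromy_trace_def mat2_trace add_divide_distrib)
qed

text \<open>
  Replacing \<open>z\<close> by \<open>\<zeta> * z\<close> shifts the sequence of \<open>q\<close> diagonal values by one place, cyclically,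
  which leaves the trace unchanged.  The polynomial \<open>z ^ q\<close> times the trace, of degree at most
  \<open>2 * q\<close>, is thus invariant under multiplication of its argument by a primitive \<open>q\<close>-th root of
  unity, and can contain only the powers \<open>0\<close>, \<open>q\<close> and \<open>2 * q\<close>.
\<close>

lemma monodromy_trace_roots_of_unity:
  fixes \<zeta> \<mu> :: complex
  assumes q: "q > 0" and root: "\<zeta> ^ q = 1" and primitive: "\<And>j. \<zeta> ^ j = 1 \<Longrightarrow> q dvd j"
  obtains c where "\<And>z. z \<noteq> 0 \<Longrightarrow>
    monodromy_trace (map (\<lambda>k. \<mu> * \<zeta> ^ k * z + \<mu> / \<zeta> ^ k / z) [1..<q + 1]) =
      c + prod_list (map (\<lambda>k. \<mu> * \<zeta> ^ k) [1..<q + 1]) * z ^ q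
        + prod_list (map (\<lambda>k. \<mu> / \<zeta> ^ k) [1..<q + 1]) / z ^ q"
proof -
  define x where "x z k = \<mu> * \<zeta> ^ k * z + \<mu> / \<zeta> ^ k / z" for z k
  define l where "l = map (\<lambda>k. (\<mu> * \<zeta> ^ k, \<mu> / \<zeta> ^ k)) [1..<q + 1]"
  have len: "length l = q" and ne: "l \<noteq> []" using q by (auto simp: l_def)
  have map_l: "map (\<lambda>(u, v). u * z + v / z) l = map (x z) [1..<q + 1]" for z
    by (simp add: l_def x_def)
  obtain F where F: "\<And>z. z \<noteq> 0 \<Longrightarrow> monodromy_trace (map (x z) [1..<q + 1]) = poly F z / z ^ q"
    and deg: "\<And>j. j > 2 * q \<Longrightarrow> coeff F j = 0"
    and ends: "coeff F 0 = prod_list (map snd l)" "coeff F (2 * q) = prod_list (map fst l)"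
    using monodromy_trace_laurent[OF ne] unfolding len map_l by metis
  have "\<zeta> \<noteq> 0" using root q by (metis power_0_left neq0_conv zero_neq_one)
  have cyclic: "monodromy_trace (map (x (\<zeta> * z)) [1..<q + 1]) = monodromy_trace (map (x z) [1..<q + 1])"
    for z
  proof -
    have shift: "x (\<zeta> * z) k = x z (Suc k)" for k
      by (simp add: x_def mult_ac)
    have period: "x z (Suc q) = x z 1"
      by (simp add: x_def root)
    have "map (x (\<zeta> * z)) [1..<q + 1] = map (x z) (map Suc [1..<q + 1])"
      by (simp add: shift)
    also have "map Suc [1..<q + 1] = [2..<q + 1] @ [Suc q]"
      using q by (simp add: map_Suc_upt numeral_2_eq_2)
    also have "monodromy_trace (map (x z) ([2..<q + 1] @ [Suc q])) =
        monodromy_trace (map (x z) ([1] @ [2..<q + 1]))"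
      by (simp only: map_append list.map period monodromy_trace_rotate)
    also have "[1] @ [2..<q + 1] = [1..<q + 1]"
      using q by (simp add: upt_conv_Cons numeral_2_eq_2)
    finally show ?thesis .
  qed
  have "pcompose F [:0, \<zeta>:] = F"
  proof (rule poly_ext)
    fix z :: complex
    show "poly (pcompose F [:0, \<zeta>:]) z = poly F z"
    proof (cases "z = 0")
      case False
      then have "poly F (\<zeta> * z) / (\<zeta> * z) ^ q = poly F z / z ^ q"
        using cyclic[of z] F[of z] F[of "\<zeta> * z"] \<open>\<zeta> \<noteq> 0\<close> by simp
      then show ?thesis
        using False by (simp add: poly_pcompose power_mult_distrib root mult.commute)
    qed (simp add: poly_pcompose)
  qed
  then have vanish: "coeff F j = 0" if "\<not> q dvd j" for j
    using that primitive[of j] coeff_pcompose_linear[of F \<zeta> j] by auto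
  have F_eq: "poly F z = coeff F 0 + coeff F q * z ^ q + coeff F (2 * q) * z ^ (2 * q)" for z
  proof -
    have "poly F z = (\<Sum>j\<le>2 * q. coeff F j * z ^ j)"
      unfolding poly_altdef
      by (intro sum.mono_neutral_left) (auto simp: coeff_eq_0 intro: degree_le deg)
    also have "\<dots> = (\<Sum>j\<in>{0, q, 2 * q}. coeff F j * z ^ j)"
    proof (intro sum.mono_neutral_right ballI)
      fix j assume j: "j \<in> {..2 * q} - {0, q, 2 * q}"
      have "\<not> q dvd j"
      proof
        assume "q dvd j"
        then obtain m where "j = q * m" by blast
        with j q have "m \<le> 2" "m \<noteq> 0" "m \<noteq> 1" "m \<noteq> 2" by auto
        then show False by simp
      qed
      then show "coeff F j * z ^ j = 0" by (simp add: vanish)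
    qed auto
    finally show ?thesis using q by simp
  qed
  show thesis
  proof (rule that[of "coeff F q"])
    fix z :: complex assume z: "z \<noteq> 0"
    have "monodromy_trace (map (x z) [1..<q + 1]) =
        coeff F q + coeff F (2 * q) * z ^ q + coeff F 0 / z ^ q"
      unfolding F[OF z] F_eq mult_2 power_add using z by (simp add: field_simps)
    moreover have "map fst l = map (\<lambda>k. \<mu> * \<zeta> ^ k) [1..<q + 1]"
      "map snd l = map (\<lambda>k. \<mu> / \<zeta> ^ k) [1..<q + 1]"
      by (simp_all add: l_def)
    ultimately show "monodromy_trace (map (\<lambda>k. \<mu> * \<zeta> ^ k * z + \<mu> / \<zeta> ^ k / z) [1..<q + 1]) =
      coeff F q + prod_list (map (\<lambda>k. \<mu> * \<zeta> ^ k) [1..<q + 1]) * z ^ q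
        + prod_list (map (\<lambda>k. \<mu> / \<zeta> ^ k) [1..<q + 1]) / z ^ q"
      using ends by (simp only: x_def [abs_def])
  qed
qed

lemma prod_list_cis:
  "prod_list (map (\<lambda>k. complex_of_real r * cis (t * real k)) [1..<n + 1]) =
     complex_of_real (r ^ n) * cis (t * (real n * (real n + 1) / 2))"
proof (induction n)
  case (Suc n)
  have "prod_list (map (\<lambda>k. complex_of_real r * cis (t * real k)) [1..<Suc n + 1]) =
      complex_of_real (r ^ Suc n) * (cis (t * (real n * (real n + 1) / 2)) * cis (t * real (Suc n)))"
    using Suc.IH by simp
  also have "cis (t * (real n * (real n + 1) / 2)) * cis (t * real (Suc n)) =
      cis (t * (real (Suc n) * (real (Suc n) + 1) / 2))"
    unfolding cis_mult by (rule arg_cong[of _ _ cis]) (simp add: field_simps)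
  finally show ?case .
qed simp

lemma cis_nat_pi: "cis (pi * real n) = (- 1) ^ n" "cis (- (pi * real n)) = (- 1) ^ n"
proof -
  show "cis (pi * real n) = (- 1) ^ n"
    using DeMoivre[of pi n] by (simp add: mult.commute)
  then show "cis (- (pi * real n)) = (- 1) ^ n"
    by (simp add: cis_inverse[symmetric] power_inverse[symmetric])
qed

lemma cis_add_cis_minus: "cis x + cis (- x) = complex_of_real (2 * cos x)"
  by (simp add: complex_eq_iff)

text \<open>
  The diagonal of Harper's operator (the almost Mathieu operator) over one period; the phase
  \<open>\<phi>\<close> is \<open>0\<close> for the determinant and \<open>\<pi> / (2 * q)\<close> for the discriminant.
\<close>

definition harper_diag :: "nat \<Rightarrow> nat \<Rightarrow> real \<Rightarrow> real \<Rightarrow> real list" where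
  "harper_diag p q lam \<phi> = map (\<lambda>k. lam * cos (2 * pi * real k * real p / real q + \<phi>)) [1..<q + 1]"

text \<open>
  Chambers' formula at energy zero: the trace depends on the phase only through
  \<open>cos (q * \<phi>)\<close>.  With \<open>z = cis \<phi>\<close>, the diagonal values are Laurent polynomials in \<open>z\<close> with coefficients
  from a geometric progression of ratio \<open>cis (2 * \<pi> * p / q)\<close>, which is a primitive \<open>q\<close>-th root of unity as
  \<open>p\<close> and \<open>q\<close> are coprime.
\<close>

lemma chambers_formula:
  assumes q: "q > 0" and coprime: "coprime p q"
  obtains c where "\<And>\<phi>. monodromy_trace (harper_diag p q lam \<phi>) =
    c + 2 * (- 1) ^ (p * (q + 1)) * (lam / 2) ^ q * cos (real q * \<phi>)"
proof -
  define t where "t = 2 * pi * real p / real q"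
  define \<mu> where "\<mu> = complex_of_real (lam / 2)"
  have pow: "cis t ^ k = cis (t * real k)" for k
    by (simp add: DeMoivre mult.commute)
  have root: "cis t ^ q = 1"
  proof -
    have "t * real q = 2 * pi * real p" using q by (simp add: t_def)
    then show ?thesis by (simp add: pow cis_multiple_2pi)
  qed
  have primitive: "q dvd j" if "cis t ^ j = 1" for j
  proof -
    from that have "cos (t * real j) = 1"
      unfolding pow by (metis cis.sel(1) one_complex.sel(1))
    then obtain m :: int where "t * real j = of_int m * 2 * pi"
      by (auto simp: cos_one_2pi_int)
    then have "real p * real j = of_int m * real q"
      using q by (simp add: t_def field_simps)
    then have "int p * int j = m * int q"
      by (metis of_int_eq_iff of_int_mult of_int_of_nat_eq)
    then have "int q dvd int (p * j)" by simp
    then have "q dvd p * j" by (simp only: int_dvd_int_iff)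
    then show ?thesis using coprime by (simp add: coprime_commute coprime_dvd_mult_right_iff)
  qed
  obtain C where C: "\<And>z. z \<noteq> 0 \<Longrightarrow>
      monodromy_trace (map (\<lambda>k. \<mu> * cis t ^ k * z + \<mu> / cis t ^ k / z) [1..<q + 1]) =
        C + prod_list (map (\<lambda>k. \<mu> * cis t ^ k) [1..<q + 1]) * z ^ q
          + prod_list (map (\<lambda>k. \<mu> / cis t ^ k) [1..<q + 1]) / z ^ q"
    using monodromy_trace_roots_of_unity[OF q root primitive] by blast
  have exponent: "t * (real q * (real q + 1) / 2) = pi * real (p * (q + 1))"
    using q by (simp add: t_def field_simps)
  have ends: "prod_list (map (\<lambda>k. \<mu> * cis t ^ k) [1..<q + 1]) = \<mu> ^ q * (- 1) ^ (p * (q + 1))"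
    "prod_list (map (\<lambda>k. \<mu> / cis t ^ k) [1..<q + 1]) = \<mu> ^ q * (- 1) ^ (p * (q + 1))"
  proof -
    show "prod_list (map (\<lambda>k. \<mu> * cis t ^ k) [1..<q + 1]) = \<mu> ^ q * (- 1) ^ (p * (q + 1))"
      unfolding pow \<mu>_def prod_list_cis exponent cis_nat_pi by simp
    have "\<mu> / cis t ^ k = \<mu> * cis (- t * real k)" for k
      by (simp add: pow divide_inverse cis_inverse)
    then have "prod_list (map (\<lambda>k. \<mu> / cis t ^ k) [1..<q + 1]) =
        prod_list (map (\<lambda>k. \<mu> * cis (- t * real k)) [1..<q + 1])"
      by simp
    also have "\<dots> = \<mu> ^ q * (- 1) ^ (p * (q + 1))"
    proof -
      have "- t * (real q * (real q + 1) / 2) = - (pi * real (p * (q + 1)))"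
        using exponent by simp
      then show ?thesis
        by (simp only: \<mu>_def prod_list_cis cis_nat_pi) simp
    qed
    finally show "prod_list (map (\<lambda>k. \<mu> / cis t ^ k) [1..<q + 1]) = \<mu> ^ q * (- 1) ^ (p * (q + 1))" .
  qed
  show thesis
  proof (rule that[of "Re C"])
    fix \<phi>
    have entry: "complex_of_real (lam * cos (2 * pi * real k * real p / real q + \<phi>)) =
        \<mu> * cis t ^ k * cis \<phi> + \<mu> / cis t ^ k / cis \<phi>" for k
    proof -
      have "\<mu> * cis t ^ k * cis \<phi> + \<mu> / cis t ^ k / cis \<phi> =
          \<mu> * (cis (t * real k + \<phi>) + cis (- (t * real k + \<phi>)))"
        by (simp add: pow divide_inverse cis_inverse cis_mult mult.assoc distrib_left del: minus_add_distrib)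
          (simp add: cis_mult)
      also have "cis (t * real k + \<phi>) + cis (- (t * real k + \<phi>)) =
          complex_of_real (2 * cos (t * real k + \<phi>))"
        by (rule cis_add_cis_minus)
      finally show ?thesis
        by (simp add: \<mu>_def t_def mult_ac)
    qed
    have "complex_of_real (monodromy_trace (harper_diag p q lam \<phi>)) =
        monodromy_trace (map complex_of_real (harper_diag p q lam \<phi>))"
      by (rule monodromy_trace_hom) simp_all
    also have "\<dots> = C + \<mu> ^ q * (- 1) ^ (p * (q + 1)) * cis \<phi> ^ q
        + \<mu> ^ q * (- 1) ^ (p * (q + 1)) / cis \<phi> ^ q"
      using C[of "cis \<phi>"] unfolding ends
      by (simp only: harper_diag_def map_map comp_def entry cis_neq_zero not_False_eq_True simp_thms)
    also have "\<dots> = C + \<mu> ^ q * (- 1) ^ (p * (q + 1)) * (cis (real q * \<phi>) + cis (- (real q * \<phi>)))"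
      by (simp add: DeMoivre divide_inverse distrib_left)
    also have "cis (real q * \<phi>) + cis (- (real q * \<phi>)) = complex_of_real (2 * cos (real q * \<phi>))"
      by (rule cis_add_cis_minus)
    also have "C + \<mu> ^ q * (- 1) ^ (p * (q + 1)) * \<dots> =
        C + complex_of_real (2 * (- 1) ^ (p * (q + 1)) * (lam / 2) ^ q * cos (real q * \<phi>))"
      by (simp add: \<mu>_def)
    finally show "monodromy_trace (harper_diag p q lam \<phi>) =
        Re C + 2 * (- 1) ^ (p * (q + 1)) * (lam / 2) ^ q * cos (real q * \<phi>)"
      by (metis Re_complex_of_real plus_complex.sel(1))
  qed
qed

section \<open>The constant term\<close>

lemma length_harper_diag: "length (harper_diag p q lam \<phi>) = q"
  by (simp add: harper_diag_def del: upt_Suc)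

text \<open>
  At phase \<open>\<pi> / 2\<close> the diagonal values are multiples of \<open>- sin (2 * \<pi> * k * p / q)\<close>: they vanish at
  \<open>k = q / 2\<close> and \<open>k = q\<close>, and change sign under \<open>k \<mapsto> q - k\<close>.
\<close>

lemma harper_diag_quarter_phase:
  assumes m: "m > 0" and q: "q = 2 * m"
  shows "\<exists>cs. length cs = m - 1 \<and> harper_diag p q lam (pi / 2) = cs @ [0] @ map uminus (rev cs) @ [0]"
proof -
  define f where "f k = lam * cos (2 * pi * real k * real p / real q + pi / 2)" for k
  have f: "f k = - lam * sin (2 * pi * real k * real p / real q)" for k
    by (simp add: f_def cos_add)
  have f_m: "f m = 0"
  proof -
    have "2 * pi * real m * real p / real q = real p * pi" using m by (simp add: q)
    then show ?thesis by (simp only: f sin_npi mult_zero_right)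
  qed
  have reflect: "f (q - k) = - f k" if "k \<le> q" for k
  proof -
    have "2 * pi * real (q - k) * real p / real q = 2 * real p * pi - 2 * pi * real k * real p / real q"
      using m that by (simp add: of_nat_diff q field_simps)
    moreover have "sin (2 * real p * pi - x) = - sin x" for x
      by (simp add: sin_diff)
    ultimately show ?thesis by (simp add: f)
  qed
  have "f q = 0" using reflect[of 0] by (simp add: f)
  define cs where "cs = map f [1..<m]"
  have "[1..<q + 1] = [1..<m] @ [m] @ [m + 1..<q] @ [q]"
    using m upt_add_eq_append[of 1 m "m + 1"] by (simp add: q upt_conv_Cons mult_2)
  moreover have "map f [m + 1..<q] = map uminus (rev cs)"
  proof (rule nth_equalityI)
    show "length (map f [m + 1..<q]) = length (map uminus (rev cs))"
      by (simp add: cs_def q)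
    fix i assume "i < length (map f [m + 1..<q])"
    then have i: "i < m - 1" by (simp add: q)
    have "map uminus (rev cs) ! i = - f (m - 1 - i)"
      using i by (simp add: cs_def rev_nth Suc_diff_Suc)
    also have "\<dots> = f (q - (m - 1 - i))"
      by (rule reflect[symmetric]) (simp add: q)
    also have "q - (m - 1 - i) = m + 1 + i"
      using i by (simp add: q)
    finally show "map f [m + 1..<q] ! i = map uminus (rev cs) ! i"
      using i by (simp add: q)
  qed
  ultimately have "harper_diag p q lam (pi / 2) = cs @ [0] @ map uminus (rev cs) @ [0]"
    using f_m \<open>f q = 0\<close> unfolding harper_diag_def f_def[symmetric] by (simp add: cs_def)
  moreover have "length cs = m - 1" by (simp add: cs_def)
  ultimately show ?thesis by blast
qed

text \<open>
  The additive constant in Chambers' formula is found from the phase \<open>\<pi> / 2\<close>, where the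
  trace is known by the antisymmetry of the diagonal.
\<close>

lemma harper_trace_even:
  assumes q: "q > 0" "even q" and coprime: "coprime p q"
  shows "monodromy_trace (harper_diag p q lam \<phi>) =
    2 * (- 1) ^ (q div 2) * (1 + (lam / 2) ^ q) - 2 * (lam / 2) ^ q * cos (real q * \<phi>)"
proof -
  obtain c where c: "\<And>\<phi>. monodromy_trace (harper_diag p q lam \<phi>) =
      c + 2 * (- 1) ^ (p * (q + 1)) * (lam / 2) ^ q * cos (real q * \<phi>)"
    using chambers_formula[OF q(1) coprime] by blast
  obtain m where m: "q = 2 * m" using q(2) by blast
  have "odd p"
    using coprime q(2) by (metis coprime_common_divisor odd_one)
  then have sign: "(- 1 :: real) ^ (p * (q + 1)) = - 1"
    using q(2) by simp
  have "m > 0" using q m by simp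
  obtain cs where cs: "length cs = m - 1" "harper_diag p q lam (pi / 2) = cs @ [0] @ map uminus (rev cs) @ [0]"
    using harper_diag_quarter_phase[OF \<open>m > 0\<close> m] by blast
  have "monodromy_trace (harper_diag p q lam (pi / 2)) = 2 * (- 1) ^ m"
    unfolding cs(2) monodromy_trace_antisymmetric cs(1) using \<open>m > 0\<close> by (cases m) simp_all
  moreover have "cos (real q * (pi / 2)) = (- 1) ^ m"
    by (simp add: m)
  ultimately have "c = 2 * (- 1) ^ m * (1 + (lam / 2) ^ q)"
    using c[of "pi / 2"] unfolding sign by (simp add: algebra_simps)
  then show ?thesis
    unfolding c sign by (simp add: m)
qed

text \<open>
  Increasing the phase by \<open>\<pi>\<close> negates the diagonal and hence, for odd \<open>q\<close>, the trace.  As it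
  also negates \<open>cos (q * \<phi>)\<close>, the additive constant in Chambers' formula must vanish.
\<close>

lemma harper_trace_odd:
  assumes "odd q" and coprime: "coprime p q"
  shows "monodromy_trace (harper_diag p q lam \<phi>) = 2 * (lam / 2) ^ q * cos (real q * \<phi>)"
proof -
  have "q > 0" using assms(1) by (cases q) auto
  then obtain c where c: "\<And>\<phi>. monodromy_trace (harper_diag p q lam \<phi>) =
      c + 2 * (- 1) ^ (p * (q + 1)) * (lam / 2) ^ q * cos (real q * \<phi>)"
    using chambers_formula[OF _ coprime] by blast
  have "harper_diag p q lam pi = map uminus (harper_diag p q lam 0)"
    by (simp add: harper_diag_def del: upt_Suc)
  then have "monodromy_trace (harper_diag p q lam pi) = - monodromy_trace (harper_diag p q lam 0)"
    using assms(1) by (simp add: monodromy_trace_uminus length_harper_diag)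
  moreover have "cos (real q * pi) = - 1"
    using assms(1) by simp
  ultimately have "c = 0"
    using c[of 0] c[of pi] by simp
  then show ?thesis
    unfolding c using assms(1) by simp
qed

text \<open>
  At \<open>x = 0\<close> the diagonal enters with a minus sign, which accounts for \<open>(- 1) ^ q\<close>.
\<close>

lemma discriminant_at_zero:
  "poly (discriminant p q lam) 0 = (- 1) ^ q * monodromy_trace (harper_diag p q lam (pi / (2 * real q)))"
proof -
  define b where "b k = lam * cos (2 * pi * real k * real p / real q + pi / (2 * real q))" for k
  have "discriminant p q lam = monodromy_trace (map (\<lambda>k. [:- b k, 1:]) [1..<q + 1])"
    by (simp add: discriminant_def monodromy_trace_def monodromy_def transfer_mat_def[abs_def]
      mat2_def b_def comp_def del: upt_Suc)
  then have "poly (discriminant p q lam) 0 =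
      poly (monodromy_trace (map (\<lambda>k. [:- b k, 1:]) [1..<q + 1])) 0"
    by (rule arg_cong)
  also have "\<dots> = monodromy_trace (map (\<lambda>P. poly P 0) (map (\<lambda>k. [:- b k, 1:]) [1..<q + 1]))"
    by (rule monodromy_trace_hom) simp_all
  also have "\<dots> = monodromy_trace (map uminus (harper_diag p q lam (pi / (2 * real q))))"
    by (simp add: harper_diag_def b_def comp_def del: upt_Suc)
  also have "\<dots> = (- 1) ^ q * monodromy_trace (harper_diag p q lam (pi / (2 * real q)))"
    by (simp add: monodromy_trace_uminus length_harper_diag)
  finally show ?thesis .
qed

theorem corollary2p6:
  fixes p q :: nat and \<theta> lam :: real and a :: "nat \<Rightarrow> real"
  assumes "1 \<le> p" and "p < q" and "coprime p q"
    and "\<theta> = real p / real q"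
    and "lam > 0"
    and "\<And>k. 1 \<le> k \<Longrightarrow> k \<le> q \<Longrightarrow> a k = lam * cos (2 * pi * real k * \<theta>)"
  shows "(q mod 4 = 0 \<longrightarrow> D q a = 0)
       \<and> (q mod 4 = 1 \<or> q mod 4 = 3 \<longrightarrow> D q a = 2 * (1 + (lam / 2) ^ q))
       \<and> (q mod 4 = 2 \<longrightarrow> D q a = - 4 * (1 + (lam / 2) ^ q))
       \<and> (even q \<longrightarrow>
           poly (discriminant p q lam) 0 = (- 1) ^ (q div 2) * 2 * (1 + (lam / 2) ^ q))"
proof -
  have q: "2 \<le> q" "q > 0" using assms(1,2) by simp_all
  have "map a [1..<q + 1] = harper_diag p q lam 0"
    unfolding harper_diag_def by (rule map_cong[OF refl]) (simp add: assms(4,6) del: upt_Suc)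
  then have D: "D q a = monodromy_trace (harper_diag p q lam 0) - 2 * (- 1) ^ q"
    by (simp add: D_eq_monodromy_trace[OF q(1)] del: upt_Suc)
  have even: "D q a = 2 * (- 1) ^ (q div 2) * (1 + (lam / 2) ^ q) - 2 * (1 + (lam / 2) ^ q)"
    if "even q"
    unfolding D harper_trace_even[OF q(2) that assms(3)] using that by simp
  have "D q a = 0" if "q mod 4 = 0"
  proof -
    have "even q" "even (q div 2)" using that by presburger+
    then show ?thesis using even by simp
  qed
  moreover have "D q a = 2 * (1 + (lam / 2) ^ q)" if "q mod 4 = 1 \<or> q mod 4 = 3"
  proof -
    have "odd q" using that by presburger
    then show ?thesis unfolding D harper_trace_odd[OF \<open>odd q\<close> assms(3)] by simp
  qed
  moreover have "D q a = - 4 * (1 + (lam / 2) ^ q)" if "q mod 4 = 2"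
  proof -
    have "even q" "odd (q div 2)" using that by presburger+
    then show ?thesis using even by simp
  qed
  moreover have "poly (discriminant p q lam) 0 = (- 1) ^ (q div 2) * 2 * (1 + (lam / 2) ^ q)"
    if "even q"
  proof -
    have "real q * (pi / (2 * real q)) = pi / 2" using q by simp
    then show ?thesis
      unfolding discriminant_at_zero harper_trace_even[OF q(2) that assms(3)]
      using that by (simp only: cos_pi_half) simp
  qed
  ultimately show ?thesis by blast
qed

end
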